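(* Let $c\in[-1,1]^{\binom V2}$ and define $f_c:\{\pm1\}^V\to\mathbb{R}$ by $f_c(x)=\sum_{\{i,j\}\in\binom V2}c_{\{i,j\}}x_ix_j$. Let $X$ be distributed according to an Ising model on $V$, $|V|=n$, with no node potentials ($\theta_v=0$ for all $v$), in the high-temperature regime. Then $\mathbf{Var}(f_c(X))=\tilde O(n^2)$.
   Context: An Ising model on vertex set $V$ is the distribution on $\{-1,1\}^V$ with $p(x)\propto\exp\big(\sum_{v}\theta_v x_v+\sum_{u\ne v}\theta_{uv}x_ux_v\big)$. High-temperature regime (Dobrushin's condition): $\max_{v}\sum_{u\ne v}\tanh(|\theta_{uv}|)\le1-\eta$ for some constant $\eta>0$. $\tilde O$ hides polylogarithmic factors in $n$. *)

theory Defs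
  imports "HOL-Probability.Probability" "HOL-Library.Landau_Symbols"
begin

definition pairs :: "'a set \<Rightarrow> 'a set set" where
  "pairs V = {e. e \<subseteq> V \<and> card e = 2}"

definition configs :: "'a set \<Rightarrow> ('a \<Rightarrow> real) set" where
  "configs V = V \<rightarrow>\<^sub>E {-1, 1}"

(* Coefficients on unordered pairs are functions on two-element sets e = {i, j};
   the product over e is then x i * x j. *)
definition quadratic_form :: "'a set \<Rightarrow> ('a set \<Rightarrow> real) \<Rightarrow> ('a \<Rightarrow> real) \<Rightarrow> real" where
  "quadratic_form V c x = (\<Sum>e\<in>pairs V. c e * (\<Prod>v\<in>e. x v))"

(* Each unordered pair {u, v} contributes theta_uv x_u x_v exactly once. This is the
   normalisation for which the influence of u on v is at most tanh |theta_uv|. *)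
definition ising_weight ::
    "'a set \<Rightarrow> ('a \<Rightarrow> real) \<Rightarrow> ('a set \<Rightarrow> real) \<Rightarrow> ('a \<Rightarrow> real) \<Rightarrow> real" where
  "ising_weight V h \<theta> x = exp ((\<Sum>v\<in>V. h v * x v) + quadratic_form V \<theta> x)"

definition partition_function :: "'a set \<Rightarrow> ('a \<Rightarrow> real) \<Rightarrow> ('a set \<Rightarrow> real) \<Rightarrow> real" where
  "partition_function V h \<theta> = (\<Sum>x\<in>configs V. ising_weight V h \<theta> x)"

(* Meaningful for finite V only; see pmf_ising below. *)
definition ising_pmf :: "'a set \<Rightarrow> ('a \<Rightarrow> real) \<Rightarrow> ('a set \<Rightarrow> real) \<Rightarrow> ('a \<Rightarrow> real) pmf" where
  "ising_pmf V h \<theta> =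
     embed_pmf (\<lambda>x. if x \<in> configs V then ising_weight V h \<theta> x / partition_function V h \<theta> else 0)"

lemma finite_configs: "finite V \<Longrightarrow> finite (configs V)"
  unfolding configs_def by (intro finite_PiE) auto

lemma configs_nonempty: "configs V \<noteq> {}"
  unfolding configs_def by (simp add: PiE_eq_empty_iff)

lemma ising_weight_pos: "ising_weight V h \<theta> x > 0"
  unfolding ising_weight_def by simp

lemma partition_function_pos: "finite V \<Longrightarrow> partition_function V h \<theta> > 0"
  unfolding partition_function_def
  by (intro sum_pos finite_configs configs_nonempty ising_weight_pos)

lemma pmf_ising:
  assumes "finite V"
  shows "pmf (ising_pmf V h \<theta>) x =
    (if x \<in> configs V then ising_weight V h \<theta> x / partition_function V h \<theta> else 0)"
  unfolding ising_pmf_def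
proof (rule pmf_embed_pmf)
  let ?Z = "partition_function V h \<theta>"
  let ?f = "\<lambda>x. if x \<in> configs V then ising_weight V h \<theta> x / ?Z else 0"
  show nonneg: "0 \<le> ?f x" for x
    using partition_function_pos[OF assms, of h \<theta>] ising_weight_pos[of V h \<theta> x]
    by (auto intro!: divide_nonneg_pos)
  have "(\<integral>\<^sup>+x. ennreal (?f x) \<partial>count_space UNIV) = (\<Sum>x\<in>configs V. ennreal (?f x))"
    by (intro nn_integral_count_space') (auto simp: finite_configs assms)
  also have "\<dots> = ennreal (\<Sum>x\<in>configs V. ?f x)"
    using nonneg by (intro sum_ennreal)
  also have "(\<Sum>x\<in>configs V. ?f x) = (\<Sum>x\<in>configs V. ising_weight V h \<theta> x) / ?Z"
    by (simp add: sum_divide_distrib)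
  also have "\<dots> = 1"
    using partition_function_pos[OF assms, of h \<theta>] by (simp add: partition_function_def)
  finally show "(\<integral>\<^sup>+x. ennreal (?f x) \<partial>count_space UNIV) = 1" by simp
qed

definition high_temperature :: "'a set \<Rightarrow> ('a set \<Rightarrow> real) \<Rightarrow> real \<Rightarrow> bool" where
  "high_temperature V \<theta> \<eta> \<longleftrightarrow> (\<forall>v\<in>V. (\<Sum>u\<in>V - {v}. tanh \<bar>\<theta> {u, v}\<bar>) \<le> 1 - \<eta>)"

(* O up to polylogarithmic factors in the argument n. *)
definition soft_O :: "(nat \<Rightarrow> real) \<Rightarrow> (nat \<Rightarrow> real) set" where
  "soft_O g = (\<Union>k::nat. O(\<lambda>n. g n * ln (real n) ^ k))"

end

(* The variance bound is two applications of a Poincare inequality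
   eta Var f <= 1/2 sum_v E (f - f o flip_v)^2: for the quadratic form, the discrete derivative at v
   is a linear form with coefficients at most 1, and by spin symmetry that form has mean zero, so a
   second application bounds its second moment by 2n/eta.
   The Poincare inequality is the spectral gap eta/n of the Glauber dynamics P. Dobrushin's condition
   makes P contract the maximal oscillation of f under a single flip by 1 - eta/n; since P is
   self-adjoint, this decay rate bounds its Rayleigh quotient on mean-zero functions. *)

theory Submission imports Defs begin

section \<open>Spin flips\<close>

definition flip :: "'a \<Rightarrow> ('a \<Rightarrow> real) \<Rightarrow> 'a \<Rightarrow> real" where
  "flip v x = x(v := - x v)"

lemma flip_same [simp]: "flip v x v = - x v"
  by (simp add: flip_def)

lemma flip_other [simp]: "u \<noteq> v \<Longrightarrow> flip v x u = x u"
  by (simp add: flip_def)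

lemma flip_flip [simp]: "flip v (flip v x) = x"
  by (simp add: flip_def)

lemma flip_commute: "flip u (flip v x) = flip v (flip u x)"
  by (auto simp: flip_def fun_eq_iff)

lemma configs_value: "x \<in> configs V \<Longrightarrow> v \<in> V \<Longrightarrow> x v = -1 \<or> x v = 1"
  by (auto simp: configs_def PiE_iff)

lemma configs_abs: "x \<in> configs V \<Longrightarrow> v \<in> V \<Longrightarrow> \<bar>x v\<bar> = 1"
  using configs_value[of x V v] by auto

lemma flip_in_configs [simp]: "v \<in> V \<Longrightarrow> x \<in> configs V \<Longrightarrow> flip v x \<in> configs V"
  by (auto simp: flip_def configs_def PiE_iff extensional_def)

lemma sum_configs_flip:
  "v \<in> V \<Longrightarrow> (\<Sum>x\<in>configs V. g (flip v x)) = (\<Sum>x\<in>configs V. g x)"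
  by (rule sum.reindex_bij_witness[of _ "flip v" "flip v"]) auto

section \<open>Lipschitz bounds on the cube\<close>

text \<open>The Lipschitz property for the Hamming distance, with \<open>M\<close> any upper bound
  rather than the exact constant.\<close>

definition oscillation_le :: "'a set \<Rightarrow> real \<Rightarrow> (('a \<Rightarrow> real) \<Rightarrow> real) \<Rightarrow> bool" where
  "oscillation_le V M f \<longleftrightarrow> (\<forall>u\<in>V. \<forall>x\<in>configs V. \<bar>f x - f (flip u x)\<bar> \<le> M)"

lemma oscillation_leD:
  "oscillation_le V M f \<Longrightarrow> u \<in> V \<Longrightarrow> x \<in> configs V \<Longrightarrow> \<bar>f x - f (flip u x)\<bar> \<le> M"
  by (simp add: oscillation_le_def)

text \<open>Walk from \<open>x\<close> to \<open>y\<close> by flipping one disagreeing coordinate at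
  a time. \<open>S\<close> is any set containing the disagreements, so the induction runs over
  \<open>S\<close> with \<open>y\<close> fixed.\<close>

lemma oscillation_le_diff_subset:
  assumes osc: "oscillation_le V M f" and "M \<ge> 0" and "finite S"
    and "S \<subseteq> V" and "x \<in> configs V" and y: "y \<in> configs V"
    and "\<And>v. v \<in> V \<Longrightarrow> v \<notin> S \<Longrightarrow> x v = y v"
  shows "\<bar>f x - f y\<bar> \<le> real (card S) * M"
  using assms(3-5,7)
proof (induction S arbitrary: x rule: finite_induct)
  case empty
  then have "x = y"
    using y unfolding configs_def by (intro PiE_ext[of x V _ y]) auto
  then show ?case by simp
next
  case (insert s S)
  show ?case
  proof (cases "x s = y s")
    case True
    have "\<bar>f x - f y\<bar> \<le> real (card S) * M"
      using insert.prems True by (intro insert.IH) auto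
    also have "\<dots> \<le> real (card (insert s S)) * M"
      using insert.hyps \<open>M \<ge> 0\<close> by (intro mult_right_mono) auto
    finally show ?thesis .
  next
    case False
    have s: "s \<in> V" using insert.prems by auto
    have neg: "y s = - x s"
      using False configs_value[OF y s] configs_value[OF insert.prems(2) s] by auto
    have eq: "flip s x v = y v" if "v \<in> V" "v \<notin> S" for v
      using that neg insert.prems(3)[of v] by (cases "v = s") auto
    have "\<bar>f (flip s x) - f y\<bar> \<le> real (card S) * M"
      using insert.prems s eq by (intro insert.IH) auto
    moreover have "\<bar>f x - f (flip s x)\<bar> \<le> M"
      using osc s insert.prems(2) by (rule oscillation_leD)
    ultimately have "\<bar>f x - f y\<bar> \<le> M + real (card S) * M" by linarith
    then show ?thesis using insert.hyps by (simp add: algebra_simps)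
  qed
qed

lemma oscillation_le_diff:
  assumes "finite V" and "oscillation_le V M f" and "M \<ge> 0"
    and "x \<in> configs V" and "y \<in> configs V"
  shows "\<bar>f x - f y\<bar> \<le> real (card V) * M"
  using assms by (intro oscillation_le_diff_subset[where V = V]) auto

text \<open>A crude bound suffices: in \<open>poincare\<close> it enters only the constant
  \<open>?K\<close>, not the decay rate.\<close>

lemma oscillation_le_exists:
  assumes "finite V"
  obtains M where "M \<ge> 0" and "oscillation_le V M f"
proof
  let ?M = "\<Sum>u\<in>V. \<Sum>x\<in>configs V. \<bar>f x - f (flip u x)\<bar>"
  show "?M \<ge> 0" by (intro sum_nonneg) auto
  show "oscillation_le V ?M f"
    unfolding oscillation_le_def
  proof (intro ballI)
    fix u x assume u: "u \<in> V" and x: "x \<in> configs V"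
    have "\<bar>f x - f (flip u x)\<bar> \<le> (\<Sum>x\<in>configs V. \<bar>f x - f (flip u x)\<bar>)"
      using x by (intro member_le_sum) (auto simp: finite_configs assms)
    also have "\<dots> \<le> ?M"
      using u assms
      by (intro member_le_sum[where f = "\<lambda>u. \<Sum>x\<in>configs V. \<bar>f x - f (flip u x)\<bar>"])
        (auto intro!: sum_nonneg)
    finally show "\<bar>f x - f (flip u x)\<bar> \<le> ?M" .
  qed
qed

section \<open>Glauber dynamics\<close>

locale spin_system =
  fixes V :: "'a set" and w :: "('a \<Rightarrow> real) \<Rightarrow> real"
  assumes finite_V: "finite V" and w_pos: "\<And>x. w x > 0"
begin

text \<open>The L2 inner product of the unnormalised measure. \<open>poincare\<close> is homogeneous
  in \<open>w\<close>, so normalisation waits until \<open>ising_poincare\<close>.\<close>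

definition ip :: "(('a \<Rightarrow> real) \<Rightarrow> real) \<Rightarrow> (('a \<Rightarrow> real) \<Rightarrow> real) \<Rightarrow> real" where
  "ip f g = (\<Sum>x\<in>configs V. w x * f x * g x)"

text \<open>The conditional probability of the current spin at \<open>v\<close> given the other
  spins. Hence \<open>resample v\<close> is the conditional expectation given the spins off
  \<open>v\<close>.\<close>

definition keep_prob :: "'a \<Rightarrow> ('a \<Rightarrow> real) \<Rightarrow> real" where
  "keep_prob v x = w x / (w x + w (flip v x))"

definition resample :: "'a \<Rightarrow> (('a \<Rightarrow> real) \<Rightarrow> real) \<Rightarrow> ('a \<Rightarrow> real) \<Rightarrow> real" where
  "resample v f x = keep_prob v x * f x + (1 - keep_prob v x) * f (flip v x)"

definition glauber :: "(('a \<Rightarrow> real) \<Rightarrow> real) \<Rightarrow> ('a \<Rightarrow> real) \<Rightarrow> real" where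
  "glauber f x = (\<Sum>v\<in>V. resample v f x) / real (card V)"

text \<open>An upper bound for n times the Dirichlet form of \<open>glauber\<close>: replacing the
  rates \<open>1 - keep_prob v x\<close> by 1 leaves plain squared derivatives.\<close>

definition dirichlet :: "(('a \<Rightarrow> real) \<Rightarrow> real) \<Rightarrow> real" where
  "dirichlet f = (\<Sum>v\<in>V. \<Sum>x\<in>configs V. w x * (f x - f (flip v x))\<^sup>2) / 2"

section \<open>Reversibility of heat-bath resampling\<close>

lemma keep_prob_nonneg: "keep_prob v x \<ge> 0"
  using w_pos[of x] w_pos[of "flip v x"] by (simp add: keep_prob_def)

lemma keep_prob_le_1: "keep_prob v x \<le> 1"
  using w_pos[of x] w_pos[of "flip v x"] by (simp add: keep_prob_def divide_le_eq)

lemma keep_prob_flip: "keep_prob v (flip v x) = 1 - keep_prob v x"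
  using w_pos[of x] w_pos[of "flip v x"] by (simp add: keep_prob_def field_simps)

text \<open>Both sides equal \<open>w x * w (flip v x) / (w x + w (flip v x))\<close>, which is
  symmetric under the flip.\<close>

lemma detailed_balance: "w (flip v x) * (1 - keep_prob v (flip v x)) = w x * (1 - keep_prob v x)"
  using w_pos[of x] w_pos[of "flip v x"] by (simp add: keep_prob_def field_simps)

lemma resample_const: "resample v (\<lambda>_. a) = (\<lambda>_. a)"
  by (simp add: resample_def fun_eq_iff algebra_simps)

lemma resample_flip: "resample v f (flip v x) = resample v f x"
  by (simp add: resample_def keep_prob_flip)

lemma ip_commute: "ip f g = ip g f"
  by (simp add: ip_def mult_ac)

lemma ip_self_nonneg: "ip f f \<ge> 0"
  unfolding ip_def mult.assoc
  by (intro sum_nonneg mult_nonneg_nonneg zero_le_square less_imp_le[OF w_pos])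

lemma ip_Cauchy_Schwarz: "(ip f g)\<^sup>2 \<le> ip f f * ip g g"
proof -
  have "(\<Sum>x\<in>configs V. (sqrt (w x) * f x) * (sqrt (w x) * g x))\<^sup>2 \<le>
      (\<Sum>x\<in>configs V. (sqrt (w x) * f x)\<^sup>2) * (\<Sum>x\<in>configs V. (sqrt (w x) * g x)\<^sup>2)"
    by (rule Cauchy_Schwarz_ineq_sum)
  moreover have "(sqrt (w x) * f x) * (sqrt (w x) * g x) = w x * f x * g x" for f g x
    using w_pos[of x] by simp
  ultimately show ?thesis
    by (simp add: ip_def power2_eq_square)
qed

text \<open>Detailed balance lets the sum be averaged with its image under the flip at
  \<open>v\<close>. The result is symmetric in \<open>f\<close> and \<open>g\<close>, whence
  self-adjointness; for \<open>f = g\<close> it is an energy.\<close>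

lemma ip_resample_diff:
  assumes "v \<in> V"
  shows "ip f g - ip f (resample v g) =
    (\<Sum>x\<in>configs V. w x * (1 - keep_prob v x) * ((f x - f (flip v x)) * (g x - g (flip v x)))) / 2"
proof -
  let ?s = "\<lambda>x. w x * (1 - keep_prob v x)"
  have "ip f g - ip f (resample v g) = (\<Sum>x\<in>configs V. ?s x * (f x * (g x - g (flip v x))))"
    by (simp add: ip_def resample_def sum_subtractf[symmetric] algebra_simps)
  moreover have "(\<Sum>x\<in>configs V. ?s x * (f x * (g x - g (flip v x)))) =
      (\<Sum>x\<in>configs V. ?s x * (f (flip v x) * (g (flip v x) - g x)))"
    using sum_configs_flip[OF assms, of "\<lambda>x. ?s x * (f x * (g x - g (flip v x)))"]
    by (simp add: detailed_balance)
  moreover have "(\<Sum>x\<in>configs V. ?s x * (f x * (g x - g (flip v x)))) +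
      (\<Sum>x\<in>configs V. ?s x * (f (flip v x) * (g (flip v x) - g x))) =
      (\<Sum>x\<in>configs V. ?s x * ((f x - f (flip v x)) * (g x - g (flip v x))))"
    unfolding sum.distrib[symmetric] by (intro sum.cong) (auto simp: algebra_simps)
  ultimately show ?thesis by simp
qed

lemma ip_resample_commute: "v \<in> V \<Longrightarrow> ip f (resample v g) = ip (resample v f) g"
  using ip_resample_diff[of v f g] ip_resample_diff[of v g f]
  by (simp add: ip_commute mult_ac)

lemma ip_glauber: "ip f (glauber g) = (\<Sum>v\<in>V. ip f (resample v g)) / real (card V)"
proof -
  have "ip f (glauber g) = (\<Sum>x\<in>configs V. \<Sum>v\<in>V. w x * f x * resample v g x) / real (card V)"
    by (simp add: ip_def glauber_def sum_distrib_left sum_divide_distrib)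
  also have "\<dots> = (\<Sum>v\<in>V. ip f (resample v g)) / real (card V)"
    by (subst sum.swap) (simp add: ip_def)
  finally show ?thesis .
qed

lemma ip_glauber_commute: "ip f (glauber g) = ip (glauber f) g"
proof -
  have "ip f (glauber g) = (\<Sum>v\<in>V. ip g (resample v f)) / real (card V)"
    using ip_resample_commute by (simp add: ip_glauber ip_commute)
  then show ?thesis by (simp add: ip_glauber ip_commute[of "glauber f"])
qed

lemma ip_glauber_power_commute: "ip f ((glauber ^^ t) g) = ip ((glauber ^^ t) f) g"
  by (induction t arbitrary: f g) (simp_all add: ip_glauber_commute funpow_swap1)

lemma glauber_power_const: "V \<noteq> {} \<Longrightarrow> (glauber ^^ t) (\<lambda>_. a) = (\<lambda>_. a)"
proof (induction t)
  case (Suc t)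
  then have "(glauber ^^ Suc t) (\<lambda>_. a) = glauber (\<lambda>_. a)" by simp
  then show ?case using finite_V Suc.prems by (simp add: glauber_def[abs_def] resample_const)
qed simp

lemma dirichlet_ge_ip_glauber:
  assumes "V \<noteq> {}"
  shows "real (card V) * (ip f f - ip f (glauber f)) \<le> dirichlet f"
proof -
  have "real (card V) * (ip f f - ip f (glauber f)) = (\<Sum>v\<in>V. ip f f - ip f (resample v f))"
    using assms finite_V by (simp add: ip_glauber sum_subtractf field_simps)
  also have "\<dots> \<le> (\<Sum>v\<in>V. (\<Sum>x\<in>configs V. w x * (f x - f (flip v x))\<^sup>2) / 2)"
  proof (intro sum_mono)
    fix v assume "v \<in> V"
    have "w x * (1 - keep_prob v x) * ((f x - f (flip v x)) * (f x - f (flip v x)))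
        \<le> w x * (f x - f (flip v x))\<^sup>2" for x
      unfolding power2_eq_square using w_pos[of x] keep_prob_nonneg[of v x]
      by (intro mult_right_mono) (auto simp: mult_le_cancel_left1)
    then show "ip f f - ip f (resample v f) \<le>
        (\<Sum>x\<in>configs V. w x * (f x - f (flip v x))\<^sup>2) / 2"
      unfolding ip_resample_diff[OF \<open>v \<in> V\<close>] by (intro divide_right_mono sum_mono) auto
  qed
  also have "\<dots> = dirichlet f" by (simp add: dirichlet_def sum_divide_distrib)
  finally show ?thesis .
qed

section \<open>From oscillation to Rayleigh quotients\<close>

text \<open>Mean zero makes \<open>?Z * g x\<close> the weighted sum of \<open>g x - g y\<close>
  over all \<open>y\<close>, so a bound on differences of \<open>g\<close> bounds \<open>g\<close>
  pointwise.\<close>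

lemma ip_mean_zero_bound:
  assumes mean: "ip (\<lambda>_. 1) g = 0" and osc: "oscillation_le V M g" and "M \<ge> 0"
  shows "\<bar>ip f g\<bar> \<le> (\<Sum>x\<in>configs V. w x * \<bar>f x\<bar>) * (real (card V) * M)"
proof -
  let ?Z = "\<Sum>y\<in>configs V. w y"
  have Z: "?Z > 0"
    using w_pos by (intro sum_pos finite_configs configs_nonempty finite_V)
  have g: "\<bar>g x\<bar> \<le> real (card V) * M" if x: "x \<in> configs V" for x
  proof -
    have "?Z * g x = (\<Sum>y\<in>configs V. w y * (g x - g y))"
      using mean by (simp add: ip_def sum_subtractf algebra_simps sum_distrib_left)
    then have "\<bar>?Z * g x\<bar> \<le> (\<Sum>y\<in>configs V. \<bar>w y * (g x - g y)\<bar>)" by simp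
    also have "\<dots> \<le> (\<Sum>y\<in>configs V. w y * (real (card V) * M))"
      using w_pos oscillation_le_diff[OF finite_V osc \<open>M \<ge> 0\<close> x]
      by (intro sum_mono) (auto simp: abs_mult less_imp_le)
    also have "\<dots> = ?Z * (real (card V) * M)" by (simp add: sum_distrib_right)
    finally have "?Z * \<bar>g x\<bar> \<le> ?Z * (real (card V) * M)" using Z by (simp add: abs_mult)
    then show ?thesis using Z by (simp only: mult_le_cancel_left_pos)
  qed
  have "\<bar>ip f g\<bar> \<le> (\<Sum>x\<in>configs V. \<bar>w x * f x * g x\<bar>)" by (simp add: ip_def)
  also have "\<dots> \<le> (\<Sum>x\<in>configs V. w x * \<bar>f x\<bar> * (real (card V) * M))"
    using w_pos g by (intro sum_mono) (auto simp: abs_mult less_imp_le intro!: mult_left_mono)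
  finally show ?thesis by (simp add: sum_distrib_right)
qed

text \<open>Avoids the spectral theorem: \<open>\<langle>f, P\<^sup>2\<^sup>t f\<rangle> \<ge> \<langle>f, P\<^sup>t f\<rangle>\<^sup>2 / \<langle>f, f\<rangle>\<close>, so the Rayleigh quotient
  of \<open>P\<close> at \<open>f\<close> is bounded by the decay rate of \<open>\<langle>f, P\<^sup>t f\<rangle>\<close> along powers of two.\<close>
lemma ip_glauber_le_decay_rate:
  assumes decay: "\<And>t. ip f ((glauber ^^ t) f) \<le> K * r ^ t" and "r \<ge> 0"
  shows "ip f (glauber f) \<le> r * ip f f"
proof (rule ccontr)
  assume less: "\<not> ?thesis"
  have N: "ip f f > 0"
  proof (rule ccontr)
    assume "\<not> ip f f > 0"
    then have "ip f f = 0" using ip_self_nonneg[of f] by simp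
    then show False using less ip_Cauchy_Schwarz[of f "glauber f"] by simp
  qed
  define q where "q = ip f (glauber f) / ip f f"
  have q: "r < q" using less N by (simp add: q_def field_simps)
  have lower: "q ^ (2 ^ k) * ip f f \<le> ip f ((glauber ^^ (2 ^ k)) f)" for k
  proof (induction k)
    case 0
    then show ?case using N by (simp add: q_def)
  next
    case (Suc k)
    let ?g = "(glauber ^^ (2 ^ k)) f"
    have "(q ^ (2 ^ k) * ip f f)\<^sup>2 \<le> (ip f ?g)\<^sup>2"
      using Suc.IH N q \<open>r \<ge> 0\<close> by (intro power_mono) auto
    also have "\<dots> \<le> ip f f * ip ?g ?g" by (rule ip_Cauchy_Schwarz)
    also have "ip ?g ?g = ip f ((glauber ^^ (2 ^ Suc k)) f)"
      by (simp add: ip_glauber_power_commute[symmetric] funpow_add mult_2)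
    finally have "ip f f * (q ^ (2 ^ Suc k) * ip f f) \<le> ip f f * ip f ((glauber ^^ (2 ^ Suc k)) f)"
      by (simp add: power_mult_distrib power2_eq_square power_mult[symmetric] mult_ac power_add[symmetric] mult_2)
    then show ?case using N by (simp only: mult_le_cancel_left_pos)
  qed
  have "(\<lambda>t. K * (r / q) ^ t) \<longlonglongrightarrow> K * 0"
    using q \<open>r \<ge> 0\<close> by (intro tendsto_mult tendsto_const LIMSEQ_realpow_zero) auto
  then have "\<forall>\<^sub>F t in sequentially. K * (r / q) ^ t < ip f f"
    using N by (intro order_tendstoD) auto
  then obtain T where T: "\<And>t. t \<ge> T \<Longrightarrow> K * (r / q) ^ t < ip f f"
    by (auto simp: eventually_sequentially)
  \<comment> \<open>\<open>lower\<close> speaks only of powers of two, so the contradiction needs a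
    power of two past the threshold \<open>T\<close>.\<close>
  have "T \<le> 2 ^ T" using less_exp[of T] by simp
  from T[OF this] have "K * r ^ (2 ^ T) < q ^ (2 ^ T) * ip f f"
    using q \<open>r \<ge> 0\<close> by (simp add: power_divide divide_simps mult_ac split: if_splits)
  then show False using lower[of T] decay[of "2 ^ T"] by linarith
qed

end

section \<open>Contraction under Dobrushin's condition\<close>

text \<open>\<open>a u v\<close> bounds the influence of \<open>u\<close> on \<open>v\<close>. The
  condition sums over the influenced sites \<open>v\<close>, because
  \<open>glauber_oscillation\<close> follows how a flip at \<open>u\<close> spreads.\<close>

locale dobrushin_system = spin_system +
  fixes a :: "'a \<Rightarrow> 'a \<Rightarrow> real" and \<eta> :: real
  assumes influence: "\<And>u v x. u \<in> V \<Longrightarrow> v \<in> V \<Longrightarrow> u \<noteq> v \<Longrightarrow> x \<in> configs V \<Longrightarrow>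
      \<bar>keep_prob v x - keep_prob v (flip u x)\<bar> \<le> a u v"
    and dobrushin: "\<And>u. u \<in> V \<Longrightarrow> (\<Sum>v\<in>V - {u}. a u v) \<le> 1 - \<eta>"
begin

lemma resample_oscillation:
  assumes osc: "oscillation_le V M f" and "M \<ge> 0"
    and u: "u \<in> V" and v: "v \<in> V" and uv: "u \<noteq> v" and x: "x \<in> configs V"
  shows "\<bar>resample v f x - resample v f (flip u x)\<bar> \<le> M + a u v * M"
proof -
  let ?p = "keep_prob v x" and ?q = "keep_prob v (flip u x)"
  let ?y = "flip u x"
  \<comment> \<open>Both starting points get the same weight \<open>?p\<close>: the first two terms
    compare \<open>f\<close> across a flip of \<open>u\<close>, and the last pays for the change of
    weight through a flip of \<open>v\<close>.\<close>
  have eq: "resample v f x - resample v f ?y = ?p * (f x - f ?y) +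
      (1 - ?p) * (f (flip v x) - f (flip u (flip v x))) + (?p - ?q) * (f ?y - f (flip v ?y))"
    by (simp add: resample_def flip_commute[of v u] algebra_simps)
  have 1: "\<bar>?p * (f x - f ?y)\<bar> \<le> ?p * M"
    using keep_prob_nonneg[of v x] oscillation_leD[OF osc u x]
    by (simp add: abs_mult mult_left_mono)
  have 2: "\<bar>(1 - ?p) * (f (flip v x) - f (flip u (flip v x)))\<bar> \<le> (1 - ?p) * M"
    using keep_prob_le_1[of v x] oscillation_leD[OF osc u flip_in_configs[OF v x]]
    by (simp add: abs_mult mult_left_mono)
  have 3: "\<bar>(?p - ?q) * (f ?y - f (flip v ?y))\<bar> \<le> a u v * M"
    unfolding abs_mult using influence[OF u v uv x] oscillation_leD[OF osc v flip_in_configs[OF u x]]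
    by (intro mult_mono) auto
  have "?p * M + (1 - ?p) * M = M" by (simp add: algebra_simps)
  then show ?thesis unfolding eq using 1 2 3 by linarith
qed

text \<open>Resampling \<open>u\<close> itself erases the difference. The other n - 1 sites
  contribute \<open>M\<close> each plus a total influence of at most (1 - \<eta>) M, so the average
  is at most (n - \<eta>) M / n.\<close>

lemma glauber_oscillation:
  assumes osc: "oscillation_le V M f" and "M \<ge> 0"
  shows "oscillation_le V ((1 - \<eta> / real (card V)) * M) (glauber f)"
  unfolding oscillation_le_def
proof (intro ballI)
  fix u x assume u: "u \<in> V" and x: "x \<in> configs V"
  let ?n = "real (card V)"
  have n: "?n > 0" using u finite_V by (auto simp: card_gt_0_iff)
  have cardu: "real (card (V - {u})) = ?n - 1"
    using u finite_V n by (simp add: of_nat_diff)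
  have "\<bar>glauber f x - glauber f (flip u x)\<bar> =
      \<bar>\<Sum>v\<in>V. resample v f x - resample v f (flip u x)\<bar> / ?n"
    using n by (simp add: glauber_def sum_subtractf diff_divide_distrib[symmetric] abs_divide)
  also have "(\<Sum>v\<in>V. resample v f x - resample v f (flip u x)) =
      (\<Sum>v\<in>V - {u}. resample v f x - resample v f (flip u x))"
    using u finite_V by (simp add: sum.remove[of V u] resample_flip)
  also have "\<bar>\<dots>\<bar> \<le> (\<Sum>v\<in>V - {u}. M + a u v * M)"
    by (rule order_trans[OF sum_abs])
      (use resample_oscillation[OF osc \<open>M \<ge> 0\<close> u _ _ x] in \<open>auto intro!: sum_mono\<close>)
  also have "\<dots> = (?n - 1) * M + (\<Sum>v\<in>V - {u}. a u v) * M"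
    by (simp only: sum.distrib sum_constant cardu sum_distrib_right)
  also have "\<dots> \<le> (?n - 1) * M + (1 - \<eta>) * M"
    using dobrushin[OF u] \<open>M \<ge> 0\<close> by (intro add_left_mono mult_right_mono)
  also have "\<dots> / ?n = (1 - \<eta> / ?n) * M" using n by (simp add: field_simps)
  finally show "\<bar>glauber f x - glauber f (flip u x)\<bar> \<le> (1 - \<eta> / ?n) * M"
    using n by (simp add: divide_right_mono)
qed

text \<open>Influences are nonnegative. This keeps the contraction factor 1 - \<eta>/n nonnegative,
  as the decay argument requires.\<close>

lemma eta_le_1:
  assumes "u \<in> V"
  shows "\<eta> \<le> 1"
proof -
  obtain x where x: "x \<in> configs V" using configs_nonempty[of V] by blast
  have "0 \<le> (\<Sum>v\<in>V - {u}. a u v)"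
    using influence[OF assms _ _ x] by (intro sum_nonneg) (force intro: order_trans[OF abs_ge_zero])
  then show ?thesis using dobrushin[OF assms] by linarith
qed

theorem poincare:
  assumes mean: "ip (\<lambda>_. 1) f = 0"
  shows "\<eta> * ip f f \<le> dirichlet f"
proof (cases "V = {}")
  case True
  \<comment> \<open>On the empty vertex set \<open>glauber\<close> would divide by 0; mean zero at
    the only configuration settles the case directly.\<close>
  have "configs V = {\<lambda>_. undefined}" by (simp add: configs_def True)
  then have "f (\<lambda>_. undefined) = 0" using mean w_pos[of "\<lambda>_. undefined"] by (simp add: ip_def)
  then show ?thesis unfolding ip_def dirichlet_def \<open>configs V = _\<close> by (simp add: True)
next
  case False
  let ?n = "real (card V)" and ?r = "1 - \<eta> / real (card V)"
  have n: "?n \<ge> 1" using False finite_V by (simp add: Suc_le_eq card_gt_0_iff)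
  have r: "?r \<ge> 0" using False eta_le_1 n by (auto simp: divide_le_eq)
  obtain M where "M \<ge> 0" and osc: "oscillation_le V M f"
    using oscillation_le_exists[OF finite_V] by blast
  have osc_t: "oscillation_le V (?r ^ t * M) ((glauber ^^ t) f)" for t
  proof (induction t)
    case (Suc t)
    then show ?case
      using glauber_oscillation[OF Suc.IH] r \<open>M \<ge> 0\<close> by (simp add: mult_ac)
  qed (simp add: osc)
  have mean_t: "ip (\<lambda>_. 1) ((glauber ^^ t) f) = 0" for t
    using mean False by (simp add: ip_glauber_power_commute glauber_power_const)
  \<comment> \<open>The constant may depend on \<open>f\<close>; what matters is that it is free of
    \<open>t\<close>.\<close>
  let ?K = "(\<Sum>x\<in>configs V. w x * \<bar>f x\<bar>) * ?n * M"
  have "ip f ((glauber ^^ t) f) \<le> ?K * ?r ^ t" for t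
    using ip_mean_zero_bound[OF mean_t osc_t, of t f] r \<open>M \<ge> 0\<close> by (simp add: mult_ac)
  then have "ip f (glauber f) \<le> ?r * ip f f"
    using r by (rule ip_glauber_le_decay_rate)
  \<comment> \<open>The one-step gap is \<eta>/n; the factor n undoes the uniform choice of a
    site.\<close>
  then have "?n * (\<eta> / ?n * ip f f) \<le> ?n * (ip f f - ip f (glauber f))"
    using n by (intro mult_left_mono) (auto simp: algebra_simps)
  also have "\<dots> \<le> dirichlet f" using False by (rule dirichlet_ge_ip_glauber)
  finally show ?thesis using n by simp
qed

end

section \<open>The Ising model\<close>

text \<open>The case \<open>s = 0\<close> is extremal and gives equality. With
  \<open>A = exp (-2 * s)\<close> and \<open>q = exp (-2 * b)\<close>, clearing denominators leaves
  the slack \<open>(1 - q) * q * (1 - A)^2\<close>.\<close>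

lemma logistic_diff_le_tanh_nonneg:
  fixes s b :: real
  assumes "b \<ge> 0"
  shows "1 / (1 + exp (-2 * (s + b))) - 1 / (1 + exp (-2 * (s - b))) \<le> tanh b"
proof -
  define A where "A = exp (-2 * s)"
  define q where "q = exp (-2 * b)"
  have A: "A > 0" and q: "q > 0" "q \<le> 1" using assms by (auto simp: A_def q_def)
  have e1: "exp (-2 * (s + b)) = A * q" and e2: "exp (-2 * (s - b)) = A / q"
    by (simp_all add: A_def q_def exp_add[symmetric] exp_diff[symmetric] algebra_simps)
  have t: "tanh b = (1 - q) / (1 + q)" by (simp add: tanh_real_altdef q_def)
  have nz: "1 + A * q > 0" "q + A > 0" using A q by (auto intro: add_pos_pos)
  then have pos: "(1 + A * q) * (q + A) > 0" by simp
  have "1 / (1 + A * q) - 1 / (1 + A / q) = 1 / (1 + A * q) - q / (q + A)"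
    using A q by (simp add: field_simps)
  also have "\<dots> = A * (1 - q) * (1 + q) / ((1 + A * q) * (q + A))"
    using nz by (subst diff_frac_eq) (auto simp: algebra_simps)
  also have "\<dots> \<le> (1 - q) / (1 + q)"
  proof -
    have "0 \<le> (1 - q) * (q * (1 - A)\<^sup>2)" using q by simp
    also have "\<dots> = (1 - q) * ((1 + A * q) * (q + A)) - A * (1 - q) * (1 + q) * (1 + q)"
      by (simp add: power2_eq_square algebra_simps)
    finally show ?thesis using pos q by (simp add: divide_le_eq pos_le_divide_eq field_simps)
  qed
  finally show ?thesis unfolding e1 e2 t .
qed

lemma logistic_diff_le_tanh:
  fixes s b :: real
  shows "\<bar>1 / (1 + exp (-2 * (s + b))) - 1 / (1 + exp (-2 * (s - b)))\<bar> \<le> tanh \<bar>b\<bar>"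
proof -
  have mono: "1 / (1 + exp (-2 * (s - c))) \<le> 1 / (1 + exp (-2 * (s + c)))" if "c \<ge> 0" for c
    using that by (intro divide_left_mono) (auto intro!: mult_pos_pos add_pos_pos)
  show ?thesis
  proof (cases "b \<ge> 0")
    case True
    then show ?thesis using mono[of b] logistic_diff_le_tanh_nonneg[of b s] by simp
  next
    case False
    then show ?thesis using mono[of "-b"] logistic_diff_le_tanh_nonneg[of "-b" s] by simp
  qed
qed

section \<open>Discrete derivatives of quadratic and linear forms\<close>

lemma finite_pairs: "finite V \<Longrightarrow> finite (pairs V)"
  by (rule finite_subset[of _ "Pow V"]) (auto simp: pairs_def)

lemma pairs_containing:
  assumes "v \<in> V"
  shows "{e \<in> pairs V. v \<in> e} = (\<lambda>u. {u, v}) ` (V - {v})"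
proof (intro equalityI subsetI)
  fix e assume e: "e \<in> {e \<in> pairs V. v \<in> e}"
  then have "card e = 2" by (simp add: pairs_def)
  then obtain a b where "e = {a, b}" "a \<noteq> b" by (auto simp: card_2_iff)
  with e show "e \<in> (\<lambda>u. {u, v}) ` (V - {v})" by (auto simp: pairs_def)
next
  fix e assume "e \<in> (\<lambda>u. {u, v}) ` (V - {v})"
  with assms show "e \<in> {e \<in> pairs V. v \<in> e}" by (auto simp: pairs_def)
qed

text \<open>Only the pairs through \<open>v\<close> change sign. The derivative is a linear form in
  the other spins up to the factor \<open>2 * x v\<close>, which lowers the degree from two to
  one.\<close>

lemma quadratic_form_flip:
  assumes "finite V" and "v \<in> V"
  shows "quadratic_form V c x - quadratic_form V c (flip v x) =
    2 * x v * (\<Sum>u\<in>V - {v}. c {u, v} * x u)"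
proof -
  let ?d = "\<lambda>e. c e * (\<Prod>u\<in>e. x u) - c e * (\<Prod>u\<in>e. flip v x u)"
  have "quadratic_form V c x - quadratic_form V c (flip v x) = (\<Sum>e\<in>pairs V. ?d e)"
    by (simp add: quadratic_form_def sum_subtractf)
  also have "\<dots> = (\<Sum>e\<in>{e \<in> pairs V. v \<in> e}. ?d e)"
  proof (intro sum.mono_neutral_right finite_pairs assms ballI)
    fix e assume "e \<in> pairs V - {e \<in> pairs V. v \<in> e}"
    then have "(\<Prod>u\<in>e. flip v x u) = (\<Prod>u\<in>e. x u)" by (intro prod.cong) (auto simp: flip_def)
    then show "?d e = 0" by simp
  qed auto
  also have "\<dots> = (\<Sum>u\<in>V - {v}. ?d {u, v})"
    unfolding pairs_containing[OF assms(2)]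
    by (subst sum.reindex) (auto simp: inj_on_def doubleton_eq_iff)
  also have "\<dots> = (\<Sum>u\<in>V - {v}. 2 * x v * (c {u, v} * x u))"
    by (intro sum.cong) auto
  finally show ?thesis by (simp add: sum_distrib_left)
qed

lemma linear_form_flip:
  fixes h x :: "'a \<Rightarrow> real"
  assumes "finite V" and "v \<in> V"
  shows "(\<Sum>u\<in>V. h u * x u) - (\<Sum>u\<in>V. h u * flip v x u) = 2 * h v * x v"
proof -
  have "(\<Sum>u\<in>V - {v}. h u * flip v x u) = (\<Sum>u\<in>V - {v}. h u * x u)"
    by (intro sum.cong) auto
  then show ?thesis using assms by (simp add: sum.remove[of V v])
qed

lemma ising_dobrushin_system:
  assumes fin: "finite V" and ht: "high_temperature V \<theta> \<eta>"
  shows "dobrushin_system V (ising_weight V h \<theta>) (\<lambda>u v. tanh \<bar>\<theta> {u, v}\<bar>) \<eta>"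
proof -
  interpret spin_system V "ising_weight V h \<theta>"
    by unfold_locales (auto simp: fin ising_weight_pos)
  \<comment> \<open>The local field at \<open>v\<close>; \<open>keep_prob v x\<close> is a logistic
    function of \<open>x v * field v x\<close>.\<close>
  define field where "field v x = h v + (\<Sum>u\<in>V - {v}. \<theta> {u, v} * x u)" for v and x :: "'a \<Rightarrow> real"
  have kp: "keep_prob v x = 1 / (1 + exp (-2 * (x v * field v x)))" if "v \<in> V" for v x
  proof -
    have "ising_weight V h \<theta> (flip v x) = ising_weight V h \<theta> x * exp (-2 * (x v * field v x))"
      using quadratic_form_flip[OF fin that, of \<theta> x] linear_form_flip[OF fin that, of h x]
      unfolding ising_weight_def exp_add[symmetric]
      by (simp add: field_def algebra_simps)
    then have "ising_weight V h \<theta> x + ising_weight V h \<theta> (flip v x) =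
        ising_weight V h \<theta> x * (1 + exp (-2 * (x v * field v x)))"
      by (simp add: distrib_left)
    then show ?thesis
      using ising_weight_pos[of V h \<theta> x] by (simp add: keep_prob_def)
  qed
  show ?thesis
  proof unfold_locales
    fix u v x assume u: "u \<in> V" and v: "v \<in> V" and uv: "u \<noteq> v" and x: "x \<in> configs V"
    \<comment> \<open>Half the change of \<open>x v * field v x\<close> when \<open>u\<close> is
      flipped. Centring at the midpoint s puts the two logistic arguments at s + b and s -
      b.\<close>
    let ?b = "x v * \<theta> {u, v} * x u"
    have "field v x - field v (flip u x) = 2 * \<theta> {u, v} * x u"
      using linear_form_flip[of "V - {v}" u "\<lambda>u. \<theta> {u, v}" x] fin u uv by (simp add: field_def)
    then have "flip u x v * field v (flip u x) = (x v * field v x - ?b) - ?b"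
      using uv by (simp add: algebra_simps)
    moreover have "\<bar>?b\<bar> = \<bar>\<theta> {u, v}\<bar>"
      using configs_abs[OF x u] configs_abs[OF x v] by (simp add: abs_mult)
    ultimately show "\<bar>keep_prob v x - keep_prob v (flip u x)\<bar> \<le> tanh \<bar>\<theta> {u, v}\<bar>"
      using logistic_diff_le_tanh[of "x v * field v x - ?b" ?b] v by (simp add: kp)
  next
    \<comment> \<open>Interactions live on unordered pairs, so influence received and influence
      exerted have the same sum.\<close>
    fix u assume "u \<in> V"
    with ht have "(\<Sum>v\<in>V - {u}. tanh \<bar>\<theta> {v, u}\<bar>) \<le> 1 - \<eta>"
      unfolding high_temperature_def by blast
    then show "(\<Sum>v\<in>V - {u}. tanh \<bar>\<theta> {u, v}\<bar>) \<le> 1 - \<eta>"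
      by (simp add: insert_commute[of u])
  qed
qed

section \<open>The Poincare inequality for the Ising measure\<close>

lemma ising_expectation:
  assumes "finite V"
  shows "measure_pmf.expectation (ising_pmf V h \<theta>) f =
    (\<Sum>x\<in>configs V. ising_weight V h \<theta> x * f x) / partition_function V h \<theta>"
proof -
  have "measure_pmf.expectation (ising_pmf V h \<theta>) f =
      (\<Sum>x\<in>configs V. f x * pmf (ising_pmf V h \<theta>) x)"
    by (rule integral_measure_pmf_real)
      (auto simp: finite_configs assms set_pmf_iff pmf_ising split: if_splits)
  also have "\<dots> = (\<Sum>x\<in>configs V. ising_weight V h \<theta> x * f x / partition_function V h \<theta>)"
    by (intro sum.cong) (auto simp: pmf_ising assms)
  finally show ?thesis by (simp add: sum_divide_distrib)
qed

text \<open>Centre \<open>f\<close> and divide by the partition function; centring leaves the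
  discrete derivatives unchanged.\<close>

theorem ising_poincare:
  assumes fin: "finite V" and ht: "high_temperature V \<theta> \<eta>"
  shows "\<eta> * measure_pmf.variance (ising_pmf V h \<theta>) f \<le>
    (\<Sum>v\<in>V. measure_pmf.expectation (ising_pmf V h \<theta>) (\<lambda>x. (f x - f (flip v x))\<^sup>2)) / 2"
proof -
  interpret dobrushin_system V "ising_weight V h \<theta>" "\<lambda>u v. tanh \<bar>\<theta> {u, v}\<bar>" \<eta>
    using fin ht by (rule ising_dobrushin_system)
  let ?Z = "partition_function V h \<theta>" and ?m = "measure_pmf.expectation (ising_pmf V h \<theta>) f"
  have Z: "?Z > 0" using fin by (rule partition_function_pos)
  have "?m * ?Z = (\<Sum>x\<in>configs V. ising_weight V h \<theta> x * f x)"
    using Z by (simp add: ising_expectation fin)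
  then have "ip (\<lambda>_. 1) (\<lambda>x. f x - ?m) = 0"
    by (simp add: ip_def right_diff_distrib sum_subtractf sum_distrib_right[symmetric]
        partition_function_def mult.commute)
  then have "\<eta> * ip (\<lambda>x. f x - ?m) (\<lambda>x. f x - ?m) / ?Z \<le> dirichlet (\<lambda>x. f x - ?m) / ?Z"
    using Z by (intro divide_right_mono poincare) auto
  moreover have "measure_pmf.variance (ising_pmf V h \<theta>) f = ip (\<lambda>x. f x - ?m) (\<lambda>x. f x - ?m) / ?Z"
    by (subst ising_expectation[OF fin, of h \<theta> "\<lambda>x. (f x - ?m)\<^sup>2"])
      (simp add: ip_def power2_eq_square mult.assoc)
  moreover have "dirichlet (\<lambda>x. f x - ?m) / ?Z =
      (\<Sum>v\<in>V. measure_pmf.expectation (ising_pmf V h \<theta>) (\<lambda>x. (f x - f (flip v x))\<^sup>2)) / 2"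
    by (simp add: dirichlet_def ising_expectation fin sum_divide_distrib mult.commute)
  ultimately show ?thesis by simp
qed

section \<open>Variance of linear and quadratic forms without node potentials\<close>

lemma quadratic_form_uminus: "quadratic_form V c (\<lambda>v. - x v) = quadratic_form V c x"
proof -
  have "(\<Prod>v\<in>e. - x v) = (\<Prod>v\<in>e. x v)" if "e \<in> pairs V" for e
    using that by (simp add: pairs_def prod_uminus)
  then show ?thesis by (simp add: quadratic_form_def)
qed

text \<open>Without node potentials the exponent is a quadratic form, hence even, so global spin
  reversal preserves the measure.\<close>

lemma expectation_spin_zero:
  assumes fin: "finite V" and "v \<in> V"
  shows "measure_pmf.expectation (ising_pmf V (\<lambda>_. 0) \<theta>) (\<lambda>x. x v) = 0"
proof -
  let ?w = "ising_weight V (\<lambda>_. 0) \<theta>"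
  \<comment> \<open>Off \<open>V\<close> the value stays \<open>undefined\<close>, so the reversal
    maps \<open>configs V\<close> to itself.\<close>
  let ?neg = "\<lambda>x :: 'a \<Rightarrow> real. \<lambda>u. if u \<in> V then - x u else undefined"
  have w: "?w (?neg x) = ?w x" for x
  proof -
    have "quadratic_form V \<theta> (?neg x) = quadratic_form V \<theta> (\<lambda>u. - x u)"
      unfolding quadratic_form_def
      by (intro sum.cong arg_cong2[where f = "(*)"] prod.cong) (auto simp: pairs_def)
    then show ?thesis by (simp add: ising_weight_def quadratic_form_uminus)
  qed
  have "(\<Sum>x\<in>configs V. ?w x * x v) = (\<Sum>x\<in>configs V. ?w (?neg x) * ?neg x v)"
    by (rule sum.reindex_bij_witness[of _ ?neg ?neg])
      (auto simp: configs_def PiE_iff extensional_def fun_eq_iff w)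
  also have "\<dots> = - (\<Sum>x\<in>configs V. ?w x * x v)"
    using \<open>v \<in> V\<close> unfolding w by (simp add: sum_negf)
  finally show ?thesis by (simp add: ising_expectation fin)
qed

lemma ising_integrable:
  "finite V \<Longrightarrow> integrable (measure_pmf (ising_pmf V h \<theta>)) (f :: _ \<Rightarrow> real)"
  by (intro integrable_measure_pmf_finite finite_subset[OF _ finite_configs[of V]])
    (auto simp: set_pmf_iff pmf_ising split: if_splits)

text \<open>The mean is 0, so the second moment is the variance. The derivative at \<open>v\<close>
  is \<open>2 * b v * x v\<close>, with square at most 4, and the Poincare inequality gives 4n/2 =
  2n on its right side.\<close>

lemma second_moment_linear_form:
  assumes fin: "finite V" and ht: "high_temperature V \<theta> \<eta>" and eta: "\<eta> > 0"
    and b: "\<And>v. v \<in> V \<Longrightarrow> \<bar>b v\<bar> \<le> 1"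
  shows "measure_pmf.expectation (ising_pmf V (\<lambda>_. 0) \<theta>) (\<lambda>x. (\<Sum>v\<in>V. b v * x v)\<^sup>2)
    \<le> 2 * real (card V) / \<eta>"
proof -
  let ?p = "ising_pmf V (\<lambda>_. 0) \<theta>" and ?f = "\<lambda>x. \<Sum>v\<in>V. b v * x v"
  have mean: "measure_pmf.expectation ?p ?f = 0"
    using fin by (simp add: ising_integrable expectation_spin_zero)
  have "measure_pmf.expectation ?p (\<lambda>x. (?f x - ?f (flip v x))\<^sup>2) \<le> 4" if v: "v \<in> V" for v
  proof -
    have "(?f x - ?f (flip v x))\<^sup>2 \<le> 4" if "x \<in> configs V" for x
      unfolding linear_form_flip[OF fin v]
      using configs_value[OF that v] abs_le_square_iff[of "b v" 1] b[OF v]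
      by (auto simp: power_mult_distrib)
    then have "(\<Sum>x\<in>configs V. ising_weight V (\<lambda>_. 0) \<theta> x * (?f x - ?f (flip v x))\<^sup>2)
        \<le> (\<Sum>x\<in>configs V. ising_weight V (\<lambda>_. 0) \<theta> x * 4)"
      by (intro sum_mono mult_left_mono) (auto simp: ising_weight_pos less_imp_le)
    also have "\<dots> = 4 * partition_function V (\<lambda>_. 0) \<theta>"
      by (simp add: partition_function_def sum_distrib_right[symmetric])
    finally show ?thesis
      using partition_function_pos[OF fin] by (simp add: ising_expectation fin divide_le_eq)
  qed
  then have "(\<Sum>v\<in>V. measure_pmf.expectation ?p (\<lambda>x. (?f x - ?f (flip v x))\<^sup>2)) \<le> (\<Sum>v\<in>V. 4)"
    by (rule sum_mono)
  with ising_poincare[OF fin ht, of "\<lambda>_. 0" ?f] mean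
  have "\<eta> * measure_pmf.expectation ?p (\<lambda>x. (?f x)\<^sup>2) \<le> 2 * real (card V)" by simp
  then show ?thesis using eta by (simp add: field_simps)
qed

text \<open>Each squared derivative is 4 times the square of a linear form, so its expectation is at
  most 8n/\<eta>. Summing over n sites and halving gives 4n^2/\<eta>; the Poincare constant costs
  another 1/\<eta>.\<close>

lemma variance_quadratic_form:
  assumes fin: "finite V" and ht: "high_temperature V \<theta> \<eta>" and eta: "\<eta> > 0"
    and c: "c \<in> pairs V \<rightarrow> {-1..1}"
  shows "measure_pmf.variance (ising_pmf V (\<lambda>_. 0) \<theta>) (quadratic_form V c)
    \<le> 4 / \<eta>\<^sup>2 * real (card V) ^ 2"
proof -
  let ?p = "ising_pmf V (\<lambda>_. 0) \<theta>" and ?f = "quadratic_form V c"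
  have "measure_pmf.expectation ?p (\<lambda>x. (?f x - ?f (flip v x))\<^sup>2) \<le> 8 * real (card V) / \<eta>"
    if v: "v \<in> V" for v
  proof -
    \<comment> \<open>Padding with 0 at \<open>v\<close> extends the linear form to all of
      \<open>V\<close>, as \<open>second_moment_linear_form\<close> expects.\<close>
    define b where "b u = (if u = v then 0 else c {u, v})" for u
    have b: "\<bar>b u\<bar> \<le> 1" if "u \<in> V" for u
    proof (cases "u = v")
      case False
      then have "{u, v} \<in> pairs V" using that v by (auto simp: pairs_def)
      with c have "c {u, v} \<in> {-1..1}" by blast
      then show ?thesis using False by (simp add: b_def abs_le_iff)
    qed (simp add: b_def)
    have lin: "(\<Sum>u\<in>V - {v}. c {u, v} * x u) = (\<Sum>u\<in>V. b u * x u)" for x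
      using fin v by (simp add: sum.remove[of V v "\<lambda>u. b u * x u"]) (simp add: b_def)
    have "(?f x - ?f (flip v x))\<^sup>2 = 4 * (\<Sum>u\<in>V. b u * x u)\<^sup>2" if "x \<in> configs V" for x
      unfolding quadratic_form_flip[OF fin v] lin
      using configs_value[OF that v] by (auto simp: power_mult_distrib)
    then have "measure_pmf.expectation ?p (\<lambda>x. (?f x - ?f (flip v x))\<^sup>2) =
        measure_pmf.expectation ?p (\<lambda>x. 4 * (\<Sum>u\<in>V. b u * x u)\<^sup>2)"
      unfolding ising_expectation[OF fin] by simp
    also have "\<dots> = 4 * measure_pmf.expectation ?p (\<lambda>x. (\<Sum>u\<in>V. b u * x u)\<^sup>2)"
      by simp
    also have "\<dots> \<le> 4 * (2 * real (card V) / \<eta>)"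
      using second_moment_linear_form[where b = b, OF fin ht eta b] by simp
    finally show ?thesis by simp
  qed
  then have "(\<Sum>v\<in>V. measure_pmf.expectation ?p (\<lambda>x. (?f x - ?f (flip v x))\<^sup>2))
      \<le> (\<Sum>v\<in>V. 8 * real (card V) / \<eta>)"
    by (rule sum_mono)
  also have "\<dots> = 2 * (4 * real (card V) ^ 2 / \<eta>)" by (simp add: power2_eq_square)
  finally have "\<eta> * measure_pmf.variance ?p ?f \<le> 4 * real (card V) ^ 2 / \<eta>"
    using ising_poincare[OF fin ht, of "\<lambda>_. 0" ?f] by simp
  then show ?thesis using eta by (simp add: field_simps power2_eq_square)
qed

theorem theorem16:
  fixes \<eta> :: real
  assumes "\<eta> > 0"
  shows "\<exists>B \<in> soft_O (\<lambda>n. real n ^ 2).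
    \<forall>(V :: 'a set) (\<theta> :: 'a set \<Rightarrow> real) (c :: 'a set \<Rightarrow> real).
      finite V \<longrightarrow> high_temperature V \<theta> \<eta> \<longrightarrow> c \<in> pairs V \<rightarrow> {-1..1} \<longrightarrow>
      measure_pmf.variance (ising_pmf V (\<lambda>_. 0) \<theta>) (quadratic_form V c) \<le> B (card V)"
\<comment> \<open>The witness depends only on \<eta> and n, so it serves all \<open>V\<close>,
  \<open>\<theta>\<close> and \<open>c\<close> at once; its logarithmic exponent is 0.\<close>
proof (intro bexI[of _ "\<lambda>n. 4 / \<eta>\<^sup>2 * real n ^ 2"] allI impI)
  have "(\<lambda>n. 4 / \<eta>\<^sup>2 * real n ^ 2) \<in> O(\<lambda>n. real n ^ 2 * ln (real n) ^ 0)"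
    by (simp del: times_divide_eq_left)
  then show "(\<lambda>n. 4 / \<eta>\<^sup>2 * real n ^ 2) \<in> soft_O (\<lambda>n. real n ^ 2)"
    unfolding soft_O_def by blast
qed (use assms in \<open>auto intro!: variance_quadratic_form simp del: times_divide_eq_left\<close>)

end
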